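(* Let $(X,s)$ be a real metrizable topological vector space and let $d$ be a fixed metric on $X$ compatible with $s$. Let $f:X\to\overline{\mathbb R}$, let $x\in X$ with $f(x)\in\mathbb R$, and let $x^*\in X^*$. Put $F:=f-x^*$, i.e. $F(u)=f(u)-\langle u,x^*\rangle$. Then $$x^*\in\eth_d f(x)\quad\Longleftrightarrow\quad \mathfrak sF(x)=0.$$ Equivalently, $x^*\in\eth_d f(x)$ if and only if there are arbitrarily small radii $r>0$ on which $F(x)-\inf_{u\in\overline B_d(x;r)}F(u)=o(r)$, i.e. there is a sequence $r_n>0$, $r_n\to0$, with $\bigl(F(x)-\inf_{u\in\overline B_d(x;r_n)}F(u)\bigr)/r_n\to0$.
   Context: $\overline{\mathbb R}=[-\infty,+\infty]$; $X^*$ is the topological dual and $\langle x,x^*\rangle:=x^*(x)$. A metric is compatible with $s$ if it generates $s$. $\overline B_d(x;r):=\{y\in X\mid d(x,y)\le r\}$. Core subdifferential: for $f:X\to\overline{\mathbb R}$ and $x_0\in X$, $x_0^*\in X^*$ belongs to $\eth_d f(x_0)$ if $f(x_0)\in\mathbb R$ and there is a family $(\delta_\varepsilon)_{\varepsilon>0}\subset(0,+\infty)$ with $\limsup_{\varepsilon\downarrow0}\delta_\varepsilon/\varepsilon=+\infty$ such that $f(x_0)+\langle x-x_0,x_0^*\rangle\le f(x)+\varepsilon$ for every $\varepsilon>0$ and every $x\in\overline B_d(x_0;\delta_\varepsilon)$. If $f(x_0)\notin\mathbb R$, then $\eth_d f(x_0)=\emptyset$. Lower scale slope: for $F:X\to\overline{\mathbb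 R}$ with $F(x)\in\mathbb R$, $$\mathfrak sF(x):=\liminf_{r\downarrow0}\frac{\bigl(F(x)-\inf_{u\in\overline B_d(x;r)}F(u)\bigr)^+}{r},\qquad a^+:=\max\{a,0\}.$$ *)

theory Defs
  imports "HOL-Analysis.Analysis"
begin

class real_topological_vector = topological_ab_group_add + real_vector +
  assumes tendsto_scaleR_Pair:
    "LIM p (nhds c \<times>\<^sub>F nhds x). fst p *\<^sub>R snd p :> nhds (c *\<^sub>R x)"

definition topological_dual :: "('a::real_topological_vector \<Rightarrow> real) set" where
  "topological_dual = {xs. linear xs \<and> continuous_on UNIV xs}"

definition compatible_metric :: "('a::topological_space \<Rightarrow> 'a \<Rightarrow> real) \<Rightarrow> bool" where
  "compatible_metric d \<longleftrightarrow>
     Metric_space UNIV d \<and> Metric_space.mtopology UNIV d = (euclidean :: 'a topology)"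

abbreviation metric_cball :: "('a \<Rightarrow> 'a \<Rightarrow> real) \<Rightarrow> 'a \<Rightarrow> real \<Rightarrow> 'a set" where
  "metric_cball d \<equiv> Metric_space.mcball UNIV d"

text \<open>Only the values \<open>\<delta> \<epsilon>\<close> for \<open>\<epsilon> > 0\<close> matter, so the total function \<open>\<delta>\<close> encodes a family
  indexed by the positive reals.\<close>

definition core_subdifferential ::
  "('a::real_topological_vector \<Rightarrow> 'a \<Rightarrow> real) \<Rightarrow> ('a \<Rightarrow> ereal) \<Rightarrow> 'a \<Rightarrow> ('a \<Rightarrow> real) set" where
  "core_subdifferential d f x0 =
     {xs \<in> topological_dual.
        \<bar>f x0\<bar> \<noteq> \<infinity> \<and>
        (\<exists>\<delta> :: real \<Rightarrow> real.
           (\<forall>\<epsilon>>0. \<delta> \<epsilon> > 0) \<and>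
           Limsup (at_right 0) (\<lambda>\<epsilon>. ereal (\<delta> \<epsilon> / \<epsilon>)) = \<infinity> \<and>
           (\<forall>\<epsilon>>0. \<forall>x \<in> metric_cball d x0 (\<delta> \<epsilon>).
              f x0 + ereal (xs (x - x0)) \<le> f x + ereal \<epsilon>))}"

text \<open>Intended for points with \<open>\<bar>F x\<bar> \<noteq> \<infinity>\<close>; the difference below is then a
  well-defined extended real even if the infimum is \<open>-\<infinity>\<close>.\<close>

definition lower_scale_slope ::
  "('a \<Rightarrow> 'a \<Rightarrow> real) \<Rightarrow> ('a \<Rightarrow> ereal) \<Rightarrow> 'a \<Rightarrow> ereal" where
  "lower_scale_slope d F x =
     Liminf (at_right 0) (\<lambda>r. max (F x - (INF u \<in> metric_cball d x r. F u)) 0 / ereal r)"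

end

theory Submission
  imports Defs
begin

text \<open>Write \<open>m r\<close> for the drop \<open>F x - (INF u \<in> metric_cball d x r. F u)\<close>. Everything reduces to
  one scale condition: for every \<open>c > 0\<close> there is a radius \<open>0 < r < c\<close> with \<open>m r \<le> c * r\<close>.

  That a nonnegative quotient has lower limit \<open>0\<close> at \<open>0\<close>, and that it tends to \<open>0\<close> along some
  positive null sequence, are both restatements of this condition
  (\<open>Liminf_at_right_0_eq_0_iff\<close>, \<open>small_values_iff_null_sequence\<close>). Applied to \<open>m r / r\<close> this
  covers the slope and the sequential form.

  For the core subdifferential, linearity of \<open>xs\<close> turns the defining inequality into
  \<open>m (\<delta> \<epsilon>) \<le> \<epsilon>\<close>. A small error \<open>\<epsilon>\<close> with \<open>\<delta> \<epsilon> > \<epsilon> / c\<close> yields the radius \<open>r = \<epsilon> / c\<close>, and a good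
  radius \<open>r\<close> yields the error \<open>\<epsilon> = c * r\<close>. The difficulty is in the second direction: \<open>\<delta>\<close> must be a
  single family defined for all errors, although good radii are only known at some scales. An
  almost maximal admissible radius for each \<open>\<epsilon>\<close> solves this, since it is at least half of any good
  radius that happens to be available (\<open>radius_family_iff\<close>).\<close>

section \<open>Limits of extended real functions at zero\<close>

lemma Liminf_at_right_0_eq_0_iff:
  fixes \<phi> :: "real \<Rightarrow> ereal"
  assumes nonneg: "\<And>r. r > 0 \<Longrightarrow> 0 \<le> \<phi> r"
  shows "Liminf (at_right 0) \<phi> = 0 \<longleftrightarrow> (\<forall>c>0. \<exists>r. 0 < r \<and> r < c \<and> \<phi> r \<le> ereal c)"
proof
  assume L: "Liminf (at_right 0) \<phi> = 0"
  show "\<forall>c>0. \<exists>r. 0 < r \<and> r < c \<and> \<phi> r \<le> ereal c"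
  proof (intro allI impI, rule ccontr)
    fix c :: real
    assume c: "c > 0" and no: "\<not> (\<exists>r. 0 < r \<and> r < c \<and> \<phi> r \<le> ereal c)"
    have "eventually (\<lambda>r. ereal c \<le> \<phi> r) (at_right 0)"
      unfolding eventually_at_right_field using c no by (metis linorder_le_cases)
    then have "ereal c \<le> Liminf (at_right 0) \<phi>"
      by (rule Liminf_bounded)
    then show False using L c by simp
  qed
next
  assume small: "\<forall>c>0. \<exists>r. 0 < r \<and> r < c \<and> \<phi> r \<le> ereal c"
  have "0 \<le> Liminf (at_right 0) \<phi>"
    by (rule Liminf_bounded) (auto simp: eventually_at_right_field nonneg intro: exI[of _ 1])
  moreover have "Liminf (at_right 0) \<phi> \<le> 0"
  proof (rule ccontr)
    assume "\<not> Liminf (at_right 0) \<phi> \<le> 0"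
    then obtain y where y: "0 < ereal y" "ereal y < Liminf (at_right 0) \<phi>"
      using ereal_dense2[of 0 "Liminf (at_right 0) \<phi>"] by (auto simp: not_le)
    have "eventually (\<lambda>r. ereal y < \<phi> r) (at_right 0)"
      using y(2) by (rule less_LiminfD)
    then obtain b where b: "b > 0" "\<And>r. 0 < r \<Longrightarrow> r < b \<Longrightarrow> ereal y < \<phi> r"
      unfolding eventually_at_right_field by auto
    obtain r where r: "0 < r" "r < min b y" "\<phi> r \<le> ereal (min b y)"
      using small b(1) y(1) by (metis ereal_less(2) min_less_iff_conj)
    have "\<phi> r \<le> ereal y"
      using r(3) by (rule order_trans) simp
    moreover have "ereal y < \<phi> r"
      using r b(2) by simp
    ultimately show False by simp
  qed
  ultimately show "Liminf (at_right 0) \<phi> = 0" by (rule antisym[rotated])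
qed

lemma small_values_iff_null_sequence:
  fixes \<phi> :: "real \<Rightarrow> ereal"
  assumes nonneg: "\<And>r. r > 0 \<Longrightarrow> 0 \<le> \<phi> r"
  shows "(\<forall>c>0. \<exists>r. 0 < r \<and> r < c \<and> \<phi> r \<le> ereal c) \<longleftrightarrow>
         (\<exists>r :: nat \<Rightarrow> real. (\<forall>n. r n > 0) \<and> r \<longlonglongrightarrow> 0 \<and> (\<lambda>n. \<phi> (r n)) \<longlonglongrightarrow> 0)"
proof
  assume small: "\<forall>c>0. \<exists>r. 0 < r \<and> r < c \<and> \<phi> r \<le> ereal c"
  have "\<forall>n. \<exists>r. 0 < r \<and> r < inverse (real (Suc n)) \<and> \<phi> r \<le> ereal (inverse (real (Suc n)))"
    using small by simp
  then obtain r where r: "\<And>n. 0 < r n" "\<And>n. r n < inverse (real (Suc n))"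
      "\<And>n. \<phi> (r n) \<le> ereal (inverse (real (Suc n)))"
    by metis
  have "r \<longlonglongrightarrow> 0"
    by (rule tendsto_sandwich[OF _ _ tendsto_const LIMSEQ_inverse_real_of_nat])
      (use r in \<open>auto intro!: always_eventually less_imp_le\<close>)
  moreover have "(\<lambda>n. \<phi> (r n)) \<longlonglongrightarrow> 0"
  proof (rule tendsto_sandwich[OF _ _ tendsto_const])
    show "(\<lambda>n. ereal (inverse (real (Suc n)))) \<longlonglongrightarrow> 0"
      using LIMSEQ_inverse_real_of_nat by (simp add: zero_ereal_def)
  qed (use r nonneg in \<open>auto intro!: always_eventually\<close>)
  ultimately show "\<exists>r :: nat \<Rightarrow> real. (\<forall>n. r n > 0) \<and> r \<longlonglongrightarrow> 0 \<and> (\<lambda>n. \<phi> (r n)) \<longlonglongrightarrow> 0"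
    using r(1) by blast
next
  assume "\<exists>r :: nat \<Rightarrow> real. (\<forall>n. r n > 0) \<and> r \<longlonglongrightarrow> 0 \<and> (\<lambda>n. \<phi> (r n)) \<longlonglongrightarrow> 0"
  then obtain r :: "nat \<Rightarrow> real" where r: "\<And>n. r n > 0" "r \<longlonglongrightarrow> 0" "(\<lambda>n. \<phi> (r n)) \<longlonglongrightarrow> 0"
    by blast
  show "\<forall>c>0. \<exists>r. 0 < r \<and> r < c \<and> \<phi> r \<le> ereal c"
  proof (intro allI impI)
    fix c :: real
    assume c: "c > 0"
    have "eventually (\<lambda>n. r n < c \<and> \<phi> (r n) < ereal c) sequentially"
      using order_tendstoD(2)[OF r(2) c] order_tendstoD(2)[OF r(3), of "ereal c"] c
      by (simp add: eventually_conj_iff)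
    then obtain n where "r n < c" "\<phi> (r n) < ereal c"
      by (auto simp: eventually_sequentially)
    then show "\<exists>r. 0 < r \<and> r < c \<and> \<phi> r \<le> ereal c"
      using r(1) less_imp_le by blast
  qed
qed

text \<open>The threshold \<open>1 / c\<close> lets one parameter control both the smallness of \<open>\<epsilon>\<close> and the size of
  \<open>g \<epsilon>\<close>, in the shape that the scale condition uses.\<close>

lemma Limsup_at_right_0_eq_infinity_iff:
  fixes g :: "real \<Rightarrow> real"
  shows "Limsup (at_right 0) (\<lambda>\<epsilon>. ereal (g \<epsilon>)) = \<infinity> \<longleftrightarrow> (\<forall>c>0. \<exists>\<epsilon>. 0 < \<epsilon> \<and> \<epsilon> < c \<and> 1 / c < g \<epsilon>)"
proof
  assume L: "Limsup (at_right 0) (\<lambda>\<epsilon>. ereal (g \<epsilon>)) = \<infinity>"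
  show "\<forall>c>0. \<exists>\<epsilon>. 0 < \<epsilon> \<and> \<epsilon> < c \<and> 1 / c < g \<epsilon>"
  proof (intro allI impI, rule ccontr)
    fix c :: real
    assume c: "c > 0" and no: "\<not> (\<exists>\<epsilon>. 0 < \<epsilon> \<and> \<epsilon> < c \<and> 1 / c < g \<epsilon>)"
    have "eventually (\<lambda>\<epsilon>. ereal (g \<epsilon>) \<le> ereal (1 / c)) (at_right 0)"
      unfolding eventually_at_right_field ereal_less_eq using c no by (metis linorder_not_le)
    then have "Limsup (at_right 0) (\<lambda>\<epsilon>. ereal (g \<epsilon>)) \<le> ereal (1 / c)"
      by (rule Limsup_bounded)
    then show False using L by simp
  qed
next
  assume large: "\<forall>c>0. \<exists>\<epsilon>. 0 < \<epsilon> \<and> \<epsilon> < c \<and> 1 / c < g \<epsilon>"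
  show "Limsup (at_right 0) (\<lambda>\<epsilon>. ereal (g \<epsilon>)) = \<infinity>"
  proof (rule ccontr)
    assume "Limsup (at_right 0) (\<lambda>\<epsilon>. ereal (g \<epsilon>)) \<noteq> \<infinity>"
    then obtain K where K: "Limsup (at_right 0) (\<lambda>\<epsilon>. ereal (g \<epsilon>)) < ereal K"
      using ereal_dense2[of _ \<infinity>] by (metis ereal_infty_less(1))
    have "eventually (\<lambda>\<epsilon>. ereal (g \<epsilon>) < ereal K) (at_right 0)"
      using K by (rule Limsup_lessD)
    then obtain b where b: "b > 0" "\<And>\<epsilon>. 0 < \<epsilon> \<Longrightarrow> \<epsilon> < b \<Longrightarrow> g \<epsilon> < K"
      unfolding eventually_at_right_field by auto
    define c where "c = min b (1 / (\<bar>K\<bar> + 1))"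
    have c: "c > 0" "c \<le> b" "c \<le> 1 / (\<bar>K\<bar> + 1)"
      using b(1) by (auto simp: c_def)
    have "\<bar>K\<bar> + 1 \<le> 1 / c"
      using c(1,3) by (simp add: field_simps)
    then have "K \<le> 1 / c"
      by linarith
    then show False
      using large[rule_format, OF c(1)] b(2) c(2) by force
  qed
qed

section \<open>Families of radii and the scale condition\<close>

text \<open>Read \<open>P \<epsilon> r\<close> as ``the error on the ball of radius \<open>r\<close> is at most \<open>\<epsilon>\<close>''. From left to right,
  monotonicity allows the radius to be shrunk to exactly \<open>\<epsilon> / c\<close>. From right to left, \<open>\<delta> \<epsilon>\<close> is
  taken within a factor of two of the supremum of all admissible radii up to \<open>1\<close>; the cap keeps the
  supremum finite, and the supremum itself need not be admissible.\<close>

lemma radius_family_iff: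
  fixes P :: "real \<Rightarrow> real \<Rightarrow> bool"
  assumes mono: "\<And>\<epsilon> \<epsilon>' r r'. P \<epsilon> r \<Longrightarrow> \<epsilon> \<le> \<epsilon>' \<Longrightarrow> r' \<le> r \<Longrightarrow> P \<epsilon>' r'"
  shows "(\<exists>\<delta> :: real \<Rightarrow> real. (\<forall>\<epsilon>>0. \<delta> \<epsilon> > 0) \<and>
            Limsup (at_right 0) (\<lambda>\<epsilon>. ereal (\<delta> \<epsilon> / \<epsilon>)) = \<infinity> \<and> (\<forall>\<epsilon>>0. P \<epsilon> (\<delta> \<epsilon>))) \<longleftrightarrow>
         (\<forall>c>0. \<exists>r. 0 < r \<and> r < c \<and> P (c * r) r)"
proof
  assume "\<exists>\<delta> :: real \<Rightarrow> real. (\<forall>\<epsilon>>0. \<delta> \<epsilon> > 0) \<and>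
            Limsup (at_right 0) (\<lambda>\<epsilon>. ereal (\<delta> \<epsilon> / \<epsilon>)) = \<infinity> \<and> (\<forall>\<epsilon>>0. P \<epsilon> (\<delta> \<epsilon>))"
  then obtain \<delta> :: "real \<Rightarrow> real" where
      large: "\<And>c. c > 0 \<Longrightarrow> \<exists>\<epsilon>. 0 < \<epsilon> \<and> \<epsilon> < c \<and> 1 / c < \<delta> \<epsilon> / \<epsilon>"
      and P: "\<And>\<epsilon>. \<epsilon> > 0 \<Longrightarrow> P \<epsilon> (\<delta> \<epsilon>)"
    unfolding Limsup_at_right_0_eq_infinity_iff by metis
  show "\<forall>c>0. \<exists>r. 0 < r \<and> r < c \<and> P (c * r) r"
  proof (intro allI impI)
    fix c :: real
    assume c: "c > 0"
    \<comment> \<open>\<open>\<epsilon> < c * c\<close> makes the radius \<open>\<epsilon> / c\<close> smaller than \<open>c\<close>, and \<open>b \<le> c\<close> gives \<open>1 / c \<le> 1 / b\<close>.\<close>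
    define b where "b = min c (c * c)"
    have b: "b > 0" "b \<le> c" "b \<le> c * c"
      using c by (auto simp: b_def)
    obtain \<epsilon> where \<epsilon>: "0 < \<epsilon>" "\<epsilon> < b" "1 / b < \<delta> \<epsilon> / \<epsilon>"
      using large[OF b(1)] by blast
    have "1 / c \<le> 1 / b"
      using b c by (simp add: frac_le)
    then have "1 / c < \<delta> \<epsilon> / \<epsilon>"
      using \<epsilon>(3) by linarith
    then have "\<epsilon> / c \<le> \<delta> \<epsilon>"
      using \<epsilon>(1) c by (simp add: field_simps)
    then have "P (c * (\<epsilon> / c)) (\<epsilon> / c)"
      using mono[OF P[OF \<epsilon>(1)]] c by simp
    moreover have "0 < \<epsilon> / c" "\<epsilon> / c < c"
      using \<epsilon> b c by (simp_all add: field_simps)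
    ultimately show "\<exists>r. 0 < r \<and> r < c \<and> P (c * r) r"
      by blast
  qed
next
  assume scale: "\<forall>c>0. \<exists>r. 0 < r \<and> r < c \<and> P (c * r) r"
  have "\<exists>\<delta>. \<delta> > 0 \<and> P \<epsilon> \<delta> \<and> (\<forall>r. 0 < r \<and> r \<le> 1 \<and> P \<epsilon> r \<longrightarrow> r \<le> 2 * \<delta>)" if "\<epsilon> > 0" for \<epsilon>
  proof -
    define S where "S = {r. 0 < r \<and> r \<le> 1 \<and> P \<epsilon> r}"
    obtain r where r: "0 < r" "r < min 1 \<epsilon>" "P (min 1 \<epsilon> * r) r"
      using scale \<open>\<epsilon> > 0\<close> by (metis min_less_iff_conj zero_less_one)
    have "min 1 \<epsilon> * r \<le> \<epsilon> * 1"
      using r \<open>\<epsilon> > 0\<close> by (intro mult_mono) auto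
    then have "r \<in> S"
      using r mono[OF r(3)] by (auto simp: S_def)
    have bdd: "bdd_above S"
      unfolding S_def by (rule bdd_aboveI[of _ 1]) auto
    have "0 < Sup S"
      using cSup_upper[OF \<open>r \<in> S\<close> bdd] r(1) by linarith
    then obtain \<delta> where \<delta>: "\<delta> \<in> S" "Sup S / 2 < \<delta>"
      using less_cSupE[of "Sup S / 2" S] \<open>r \<in> S\<close> by auto
    have "r' \<le> 2 * \<delta>" if "r' \<in> S" for r'
      using cSup_upper[OF that bdd] \<delta>(2) by linarith
    then show ?thesis
      using \<delta>(1) by (auto simp: S_def)
  qed
  then obtain \<delta> where pos: "\<And>\<epsilon>. \<epsilon> > 0 \<Longrightarrow> \<delta> \<epsilon> > 0" and P: "\<And>\<epsilon>. \<epsilon> > 0 \<Longrightarrow> P \<epsilon> (\<delta> \<epsilon>)"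
      and half: "\<And>\<epsilon> r. \<epsilon> > 0 \<Longrightarrow> 0 < r \<Longrightarrow> r \<le> 1 \<Longrightarrow> P \<epsilon> r \<Longrightarrow> r \<le> 2 * \<delta> \<epsilon>"
    by metis
  have "\<exists>\<epsilon>. 0 < \<epsilon> \<and> \<epsilon> < c \<and> 1 / c < \<delta> \<epsilon> / \<epsilon>" if "c > 0" for c
  proof -
    \<comment> \<open>The divisor must exceed \<open>2\<close> to absorb the factor lost in the choice of \<open>\<delta>\<close>.\<close>
    define b where "b = min c 1 / 3"
    have b: "b > 0" "b \<le> 1" "3 * b \<le> c"
      using that by (auto simp: b_def)
    obtain r where r: "0 < r" "r < b" "P (b * r) r"
      using scale b(1) by blast
    have "b * r \<le> 1 * r"
      using b r by (intro mult_right_mono) auto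
    then have "b * r < c"
      using b r by linarith
    then have pos_br: "b * r > 0" "b * r < c"
      using b r by simp_all
    have "1 / c \<le> 1 / (3 * b)"
      using b by (simp add: frac_le)
    also have "\<dots> < 1 / (2 * b)"
      using b by (simp add: field_simps)
    also have "\<dots> \<le> \<delta> (b * r) / (b * r)"
      using half[OF pos_br(1) r(1) _ r(3)] r b by (simp add: field_simps)
    finally show ?thesis
      using pos_br by blast
  qed
  then show "\<exists>\<delta> :: real \<Rightarrow> real. (\<forall>\<epsilon>>0. \<delta> \<epsilon> > 0) \<and>
      Limsup (at_right 0) (\<lambda>\<epsilon>. ereal (\<delta> \<epsilon> / \<epsilon>)) = \<infinity> \<and> (\<forall>\<epsilon>>0. P \<epsilon> (\<delta> \<epsilon>))"
    using pos P unfolding Limsup_at_right_0_eq_infinity_iff by blast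
qed

section \<open>The core subdifferential and the lower scale slope\<close>

lemma linear_tilt_le_iff:
  fixes f :: "'a::real_vector \<Rightarrow> ereal"
  assumes "linear xs" "\<bar>f x\<bar> \<noteq> \<infinity>"
  shows "f x + ereal (xs (u - x)) \<le> f u + ereal \<epsilon> \<longleftrightarrow>
         f x - ereal (xs x) \<le> f u - ereal (xs u) + ereal \<epsilon>"
  using assms by (cases "f x"; cases "f u") (auto simp: linear_diff)

lemma drop_quotient_le_iff:
  fixes F :: "'a \<Rightarrow> ereal"
  assumes "\<bar>a\<bar> \<noteq> \<infinity>" "r > 0"
  shows "(a - (INF u\<in>B. F u)) / ereal r \<le> ereal c \<longleftrightarrow> (\<forall>u\<in>B. a \<le> F u + ereal (c * r))"
proof -
  have "(a - (INF u\<in>B. F u)) / ereal r \<le> ereal c \<longleftrightarrow> a - ereal (c * r) \<le> (INF u\<in>B. F u)"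
    using assms by (cases a; cases "INF u\<in>B. F u") (auto simp: field_simps)
  also have "\<dots> \<longleftrightarrow> (\<forall>u\<in>B. a - ereal (c * r) \<le> F u)"
    by (rule le_INF_iff)
  also have "\<dots> \<longleftrightarrow> (\<forall>u\<in>B. a \<le> F u + ereal (c * r))"
    by (simp add: ereal_minus_le)
  finally show ?thesis .
qed

theorem theorem12:
  fixes d :: "'a::real_topological_vector \<Rightarrow> 'a \<Rightarrow> real"
    and f F :: "'a \<Rightarrow> ereal"
    and x :: 'a
    and xs :: "'a \<Rightarrow> real"
  assumes "compatible_metric d"
    and "\<bar>f x\<bar> \<noteq> \<infinity>"
    and "xs \<in> topological_dual"
    and "F = (\<lambda>u. f u - ereal (xs u))"
  shows "(xs \<in> core_subdifferential d f x \<longleftrightarrow> lower_scale_slope d F x = 0) \<and>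
         (xs \<in> core_subdifferential d f x \<longleftrightarrow>
           (\<exists>r :: nat \<Rightarrow> real. (\<forall>n. r n > 0) \<and> r \<longlonglongrightarrow> 0 \<and>
              (\<lambda>n. (F x - (INF u \<in> metric_cball d x (r n). F u)) / ereal (r n)) \<longlonglongrightarrow> 0))"
proof -
  interpret M: Metric_space UNIV d
    using assms(1) by (simp add: compatible_metric_def)
  have lin: "linear xs"
    using assms(3) by (simp add: topological_dual_def)
  have Fx: "\<bar>F x\<bar> \<noteq> \<infinity>"
    using assms(2,4) by (cases "f x") auto
  define m where "m = (\<lambda>r. F x - (INF u \<in> M.mcball x r. F u))"
  define \<phi> where "\<phi> = (\<lambda>r. m r / ereal r)"
  define P where "P = (\<lambda>\<epsilon> r. \<forall>u \<in> M.mcball x r. F x \<le> F u + ereal \<epsilon>)"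
  have m_nonneg: "0 \<le> m r" if "r > 0" for r
  proof -
    have "(INF u \<in> M.mcball x r. F u) \<le> F x"
      using that by (intro INF_lower) simp
    then show ?thesis
      using Fx by (cases "F x"; cases "INF u \<in> M.mcball x r. F u") (auto simp: m_def)
  qed
  have \<phi>_nonneg: "0 \<le> \<phi> r" if "r > 0" for r
    using m_nonneg[OF that] that by (simp add: \<phi>_def)
  have \<phi>_le: "\<phi> r \<le> ereal c \<longleftrightarrow> P (c * r) r" if "r > 0" for r c
    unfolding \<phi>_def m_def P_def by (rule drop_quotient_le_iff[OF Fx that])
  have P_mono: "P \<epsilon>' r'" if "P \<epsilon> r" "\<epsilon> \<le> \<epsilon>'" "r' \<le> r" for \<epsilon> \<epsilon>' r r'
    unfolding P_def
  proof
    fix u assume "u \<in> M.mcball x r'"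
    then have "F x \<le> F u + ereal \<epsilon>"
      using that(1,3) by (auto simp: P_def)
    also have "\<dots> \<le> F u + ereal \<epsilon>'"
      using that(2) by (intro add_left_mono) simp
    finally show "F x \<le> F u + ereal \<epsilon>'" .
  qed
  have slope: "lower_scale_slope d F x = Liminf (at_right 0) \<phi>"
    unfolding lower_scale_slope_def
    by (rule Liminf_eq)
      (use m_nonneg in \<open>auto simp: eventually_at_right_field \<phi>_def m_def max_absorb1
                           intro!: exI[of _ 1]\<close>)
  have "xs \<in> core_subdifferential d f x \<longleftrightarrow>
      (\<exists>\<delta> :: real \<Rightarrow> real. (\<forall>\<epsilon>>0. \<delta> \<epsilon> > 0) \<and>
        Limsup (at_right 0) (\<lambda>\<epsilon>. ereal (\<delta> \<epsilon> / \<epsilon>)) = \<infinity> \<and> (\<forall>\<epsilon>>0. P \<epsilon> (\<delta> \<epsilon>)))"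
    using assms(2,3)
    by (simp add: core_subdifferential_def P_def assms(4) linear_tilt_le_iff[where f = f, OF lin assms(2)])
  also have "\<dots> \<longleftrightarrow> (\<forall>c>0. \<exists>r. 0 < r \<and> r < c \<and> P (c * r) r)"
    by (rule radius_family_iff) (rule P_mono)
  also have "\<dots> \<longleftrightarrow> (\<forall>c>0. \<exists>r. 0 < r \<and> r < c \<and> \<phi> r \<le> ereal c)"
    using \<phi>_le by blast
  finally have core: "xs \<in> core_subdifferential d f x \<longleftrightarrow>
      (\<forall>c>0. \<exists>r. 0 < r \<and> r < c \<and> \<phi> r \<le> ereal c)" .
  have "xs \<in> core_subdifferential d f x \<longleftrightarrow> lower_scale_slope d F x = 0"
    unfolding core slope by (rule Liminf_at_right_0_eq_0_iff[OF \<phi>_nonneg, symmetric])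
  moreover have "xs \<in> core_subdifferential d f x \<longleftrightarrow>
      (\<exists>r :: nat \<Rightarrow> real. (\<forall>n. r n > 0) \<and> r \<longlonglongrightarrow> 0 \<and> (\<lambda>n. \<phi> (r n)) \<longlonglongrightarrow> 0)"
    unfolding core by (rule small_values_iff_null_sequence[OF \<phi>_nonneg])
  ultimately show ?thesis
    by (simp add: \<phi>_def m_def)
qed

end
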